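(* Let $V$ be a finite set of variants partitioned into semantic classes $\mathcal{C}$, and let $m:V\to[0,1]$ be a score function. Let $\mathcal{G}$ be the set of score functions $\tilde m:V\to[0,1]$ satisfying: (i) classwise constancy: $\tilde m(v)=\tilde m(u)$ whenever $\mathrm{cl}(v)=\mathrm{cl}(u)$; and (ii) conservativeness: $\tilde m(v)\ge m(v)$ for all $v\in V$. Then $\mathrm{Env}(m)\in\mathcal{G}$, and for every $\tilde m\in\mathcal{G}$ and every $v\in V$, $$\mathrm{Env}(m)(v)\le \tilde m(v).$$ Hence $\mathrm{Env}(m)$ is the unique pointwise minimum of $\mathcal{G}$.
   Context: Variants and classes. $V$ is a finite set of content variants. A published audit protocol consists of a finite relation $T_0\subseteq V\times V$, a function $A:V\times V\to\{0,1\}$, a confidence score $s(v,u)\in[0,1]$ for each pair in $T_0$, and a threshold $\rho\in[0,1]$; its edge set is $E_\rho=\{(v,u)\in T_0: A(v,u)=1 \text{ and } s(v,u)\ge\rho\}$. The set $\mathcal{C}$ of semantic classes is the set of equivalence classes of the reflexive-symmetric-transitive closure of $E_\rho$, so $\mathcal{C}$ is a partition of $V$. Write $\mathrm{cl}(v)\in\mathcal{C}$ for the class containing $v$. Semantic-envelope lift. For $m:V\to[0,1]$, $\mathrm{Env}(m)(v)=\max\{m(u): u\in V,\ \mathrm{cl}(u)=\mathrm{cl}(v)\}$. *)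

theory Defs
  imports Complex_Main "HOL-Library.FuncSet" "HOL-Library.Disjoint_Sets"
begin

definition edge_set ::
  "('a \<times> 'a) set \<Rightarrow> ('a \<times> 'a \<Rightarrow> nat) \<Rightarrow> ('a \<times> 'a \<Rightarrow> real) \<Rightarrow> real \<Rightarrow> ('a \<times> 'a) set" where
  "edge_set T0 A s \<rho> = {e \<in> T0. A e = 1 \<and> s e \<ge> \<rho>}"

(* The reflexive closure is taken on V only, hence the intersection: rtrancl
   is reflexive on the whole type. *)
definition sem_equiv :: "'a set \<Rightarrow> ('a \<times> 'a) set \<Rightarrow> ('a \<times> 'a) set" where
  "sem_equiv V E = (E \<union> E\<inverse>)\<^sup>* \<inter> V \<times> V"

definition sem_classes :: "'a set \<Rightarrow> ('a \<times> 'a) set \<Rightarrow> 'a set set" where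
  "sem_classes V E = V // sem_equiv V E"

definition sem_class :: "'a set \<Rightarrow> ('a \<times> 'a) set \<Rightarrow> 'a \<Rightarrow> 'a set" where
  "sem_class V E v = sem_equiv V E `` {v}"

lemma equiv_sem_equiv: "equiv V (sem_equiv V E)"
proof (rule equivI)
  show "sem_equiv V E \<subseteq> V \<times> V" by (auto simp: sem_equiv_def)
  show "refl_on V (sem_equiv V E)" by (auto simp: sem_equiv_def refl_on_def)
  have "sym ((E \<union> E\<inverse>)\<^sup>*)" by (intro sym_rtrancl sym_Un_converse)
  then show "sym (sem_equiv V E)" by (auto simp: sem_equiv_def sym_def)
  show "trans (sem_equiv V E)" by (auto simp: sem_equiv_def trans_def)
qed

lemma partition_on_sem_classes: "partition_on V (sem_classes V E)"
  unfolding sem_classes_def by (rule partition_on_quotient[OF equiv_sem_equiv])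

lemma sem_class_in_sem_classes:
  assumes "v \<in> V"
  shows "sem_class V E v \<in> sem_classes V E" and "v \<in> sem_class V E v"
  using assms equiv_class_self[OF equiv_sem_equiv assms]
  by (auto simp: sem_class_def sem_classes_def intro: quotientI)

(* Score functions are extensional (equal to undefined outside V), so that
   equality of functions on the type is equality of functions on V. *)
definition score_functions :: "'a set \<Rightarrow> ('a \<Rightarrow> real) set" where
  "score_functions V = V \<rightarrow>\<^sub>E {0..1}"

definition Env :: "'a set \<Rightarrow> ('a \<Rightarrow> 'a set) \<Rightarrow> ('a \<Rightarrow> real) \<Rightarrow> 'a \<Rightarrow> real" where
  "Env V cl m = (\<lambda>v\<in>V. Max {m u | u. u \<in> V \<and> cl u = cl v})"

definition classwise_constant :: "'a set \<Rightarrow> ('a \<Rightarrow> 'a set) \<Rightarrow> ('a \<Rightarrow> real) \<Rightarrow> bool" where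
  "classwise_constant V cl f \<longleftrightarrow> (\<forall>v\<in>V. \<forall>u\<in>V. cl v = cl u \<longrightarrow> f v = f u)"

definition conservative :: "'a set \<Rightarrow> ('a \<Rightarrow> real) \<Rightarrow> ('a \<Rightarrow> real) \<Rightarrow> bool" where
  "conservative V m f \<longleftrightarrow> (\<forall>v\<in>V. f v \<ge> m v)"

definition conservative_lifts ::
  "'a set \<Rightarrow> ('a \<Rightarrow> 'a set) \<Rightarrow> ('a \<Rightarrow> real) \<Rightarrow> ('a \<Rightarrow> real) set" where
  "conservative_lifts V cl m =
     {f \<in> score_functions V. classwise_constant V cl f \<and> conservative V m f}"

definition is_pointwise_minimum :: "'a set \<Rightarrow> ('a \<Rightarrow> real) set \<Rightarrow> ('a \<Rightarrow> real) \<Rightarrow> bool" where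
  "is_pointwise_minimum V G f \<longleftrightarrow> f \<in> G \<and> (\<forall>g\<in>G. \<forall>v\<in>V. f v \<le> g v)"

end

theory Submission
  imports Defs
begin

text \<open>The maximum of a nonempty finite set is its least upper bound, so
  \<open>Env V cl m v\<close> is at most \<open>b\<close> exactly when \<open>b\<close> bounds
  \<open>m\<close> on the class of \<open>v\<close> (\<open>Env_le_iff\<close>). If \<open>f\<close>
  is conservative and classwise constant, then \<open>m u \<le> f u = f v\<close> for every
  \<open>u\<close> in that class; so \<open>f v\<close> is such a bound, and minimality follows
  (\<open>Env_le_conservative_lift\<close>). The envelope is itself a lift of this kind
  (\<open>Env_in_conservative_lifts\<close>), and two pointwise minima lie below each other.\<close>

lemma Env_le_iff:
  assumes "finite V" "v \<in> V"
  shows "Env V cl m v \<le> b \<longleftrightarrow> (\<forall>u\<in>V. cl u = cl v \<longrightarrow> m u \<le> b)"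
proof -
  \<comment> \<open>The set contains \<open>m v\<close>, so its \<open>Max\<close> is a genuine
    least upper bound.\<close>
  have "finite {m u | u. u \<in> V \<and> cl u = cl v}" and "{m u | u. u \<in> V \<and> cl u = cl v} \<noteq> {}"
    using assms by auto
  then show ?thesis
    using assms(2) by (auto simp: Env_def)
qed

lemma Env_ge:
  assumes "finite V" "v \<in> V"
  shows "m v \<le> Env V cl m v"
  \<comment> \<open>The bound \<open>b\<close> is the envelope value itself, and \<open>u\<close> is
    \<open>v\<close>.\<close>
  using assms Env_le_iff[OF assms, of cl m "Env V cl m v"] by blast

lemma Env_in_conservative_lifts:
  assumes "finite V" "m \<in> score_functions V"
  shows "Env V cl m \<in> conservative_lifts V cl m"
proof -
  have m: "0 \<le> m v" "m v \<le> 1" if "v \<in> V" for v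
    using assms(2) that by (auto simp: score_functions_def PiE_def Pi_def)
  have "Env V cl m v \<in> {0..1}" if "v \<in> V" for v
    \<comment> \<open>The upper bound holds because 1 bounds \<open>m\<close> on the class; the
      lower one because \<open>0 \<le> m v \<le> Env V cl m v\<close>.\<close>
    using m Env_le_iff[OF assms(1) that, of cl m 1] m(1)[OF that] Env_ge[OF assms(1) that, of m cl]
    by auto
  moreover have "Env V cl m \<in> extensional V"
    by (simp add: Env_def)
  ultimately have "Env V cl m \<in> score_functions V"
    by (auto simp: score_functions_def PiE_def)
  \<comment> \<open>On \<open>V\<close>, the set being maximized depends on \<open>v\<close> only
    through \<open>cl v\<close>.\<close>
  moreover have "classwise_constant V cl (Env V cl m)"
    by (simp add: classwise_constant_def Env_def)
  moreover have "conservative V m (Env V cl m)"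
    using Env_ge[OF assms(1)] by (auto simp: conservative_def)
  ultimately show ?thesis
    by (simp add: conservative_lifts_def)
qed

lemma Env_le_conservative_lift:
  assumes "finite V" "f \<in> conservative_lifts V cl m" "v \<in> V"
  shows "Env V cl m v \<le> f v"
  unfolding Env_le_iff[OF assms(1,3)]
  using assms(2,3)
  by (metis (mono_tags, lifting) classwise_constant_def conservative_def conservative_lifts_def mem_Collect_eq)

text \<open>Antisymmetry gives agreement on \<open>V\<close> only; extensionality of score functions
  fixes the values elsewhere and turns this into equality of functions.\<close>

lemma pointwise_minimum_unique:
  assumes "G \<subseteq> score_functions V" "is_pointwise_minimum V G f" "is_pointwise_minimum V G g"
  shows "f = g"
proof (rule PiE_ext)
  show "f \<in> V \<rightarrow>\<^sub>E {0..1}" "g \<in> V \<rightarrow>\<^sub>E {0..1}"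
    using assms by (auto simp: is_pointwise_minimum_def score_functions_def)
  show "f v = g v" if "v \<in> V" for v
    using assms(2,3) that by (auto simp: is_pointwise_minimum_def intro: antisym)
qed

theorem theorem1:
  fixes V :: "'a set"
    and T0 :: "('a \<times> 'a) set"
    and A :: "'a \<times> 'a \<Rightarrow> nat"
    and s :: "'a \<times> 'a \<Rightarrow> real"
    and \<rho> :: real
    and m :: "'a \<Rightarrow> real"
  assumes "finite V"
    and "T0 \<subseteq> V \<times> V"
    and "A \<in> V \<times> V \<rightarrow> {0, 1}"
    and "s \<in> T0 \<rightarrow> {0..1}"
    and "\<rho> \<in> {0..1}"
    and "m \<in> score_functions V"
  shows "let cl = sem_class V (edge_set T0 A s \<rho>);
             G = conservative_lifts V cl m
         in Env V cl m \<in> G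
          \<and> (\<forall>f\<in>G. \<forall>v\<in>V. Env V cl m v \<le> f v)
          \<and> (\<forall>f. is_pointwise_minimum V G f \<longleftrightarrow> f = Env V cl m)"
proof -
  define cl where "cl = sem_class V (edge_set T0 A s \<rho>)"
  define G where "G = conservative_lifts V cl m"
  have mem: "Env V cl m \<in> G"
    unfolding G_def using assms by (intro Env_in_conservative_lifts)
  have le: "\<forall>f\<in>G. \<forall>v\<in>V. Env V cl m v \<le> f v"
    unfolding G_def using Env_le_conservative_lift[OF assms(1)] by blast
  have minimum: "is_pointwise_minimum V G (Env V cl m)"
    using mem le by (simp add: is_pointwise_minimum_def)
  have "G \<subseteq> score_functions V"
    by (auto simp: G_def conservative_lifts_def)
  then have "is_pointwise_minimum V G f \<longleftrightarrow> f = Env V cl m" for f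
    using pointwise_minimum_unique minimum by blast
  with mem le show ?thesis
    by (simp add: Let_def flip: cl_def G_def)
qed

end
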